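(* Let $(X,d)$ be a doubling metric space with doubling constant $M$, let $0<\delta<\frac{1}{84M^8}$, and let $\{\bar Q^k_\alpha(\omega)\}$, $\omega\in\Omega$, be the closed dyadic cubes of the independent random dyadic system with parameter $\delta$ (built from any fixed system of dyadic points with parameter $\delta$), with probability measure $\mathbb{P}_\omega$ on $\Omega$. Put $$C:=84M^8,\qquad C_\delta:=\frac1\delta,\qquad \eta_\delta:=1-\frac{\log C}{\log(1/\delta)}.$$ Then for every $\varepsilon>0$, every $k\in\mathbb{Z}$ and every $x\in X$, $$\mathbb{P}_\omega\Big(x\in\bigcup_{\alpha}\partial_\varepsilon \bar Q^k_\alpha(\omega)\Big)\le C_\delta\Big(\frac{\varepsilon}{\delta^k}\Big)^{\eta_\delta}.$$ In particular, $\lim_{\delta\to0}\eta_\delta=1$.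
   Context: $\mathbb{N}=\{0,1,2,\dots\}$; $B(x,r)=\{y\in X: d(x,y)<r\}$. A (nonempty) metric space $(X,d)$ is a doubling metric space with doubling constant $M\in\mathbb{N}$ if every ball $B(x,r)$, $r>0$, can be covered by at most $M$ balls of radius $r/2$. The $\varepsilon$-boundary of $A\subseteq X$ is $\partial_\varepsilon A:=\{x\in A: d(x,A^c)<\varepsilon\}\cup\{x\in A^c: d(x,A)<\varepsilon\}$, with $d(x,\emptyset)=+\infty$. Dyadic points with parameter $\delta$: sets $\mathscr{A}_k=\{z^k_\alpha:\alpha\in\mathcal N_k\}$, $k\in\mathbb{Z}$, where $\mathcal N_k=\{0,1,\dots,n_k\}$ if $X$ is bounded and $\mathcal N_k=\mathbb{N}$ otherwise, such that $\mathscr{A}_k\subseteq\mathscr{A}_{k+1}$; $d(z^k_\alpha,z^k_\beta)\ge\delta^k$ for $\alpha\ne\beta$; and $\min_\alpha d(x,z^k_\alpha)<\delta^k$ for every $x\in X$. Such sets exist; they are fixed (non-random). Independent random dyadic system: $\Omega=\{0,1,\dots,\lfloor1/\delta\rfloor\}^{\mathbb{Z}}$ with the product probability measure $\mathbb{P}_\omega$ under which the coordinates $\omega_k$ ($k\in\mathbb{Z}$) are independent and uniformly distributed on $\{0,1,\dots,\lfloor1/\delta\rfloor\}$. For $\omega=(\omega_k)_{k\in\mathbb Z}\in\Omega$ put $r_k=r_k(\omega)=\frac14(\delta^k+\omega_k\delta^{k+1})$ and $R_k=R_k(\omega)=4r_k$. Cubes determined by radii $r_k\in[\frac14\delta^k,\frac12\delta^k]$,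 $R_k=4r_k$: the approximated cube is $$A^k_\alpha:=B(z^k_\alpha,r_k)\cup\Big(B(z^k_\alpha,R_k)\setminus\Big(\bigcup_{\theta\ne\alpha}B(z^k_\theta,r_k)\cup\bigcup_{\theta<\alpha}B(z^k_\theta,R_k)\Big)\Big).$$ Let $(k+1,\beta)\le(k,\alpha)$ if and only if $z^{k+1}_\beta\in A^k_\alpha$, and extend $\le$ reflexively and transitively to a partial order on the pairs $(k,\alpha)$, $k\in\mathbb{Z}$, $\alpha\in\mathcal N_k$. The closed dyadic cube is $\bar Q^k_\alpha:=\overline{\{z^l_\beta:(l,\beta)\le(k,\alpha)\}}$ and the open dyadic cube $\tilde Q^k_\alpha$ is its interior. For $\delta\le 1/60$ it is a known fact that $\overline{\tilde Q^k_\alpha}=\bar Q^k_\alpha$; $\bar Q^k_\alpha\cap\tilde Q^k_\beta=\emptyset$ for $\alpha\neq\beta$; $X=\bigcup_\alpha\bar Q^k_\alpha$ for every $k$; $B(z^k_\alpha,\frac15\delta^k)\subseteq\tilde Q^k_\alpha\subseteq\bar Q^k_\alpha\subseteq B(z^k_\alpha,3\delta^k)$; and $\bar Q^k_\alpha=\bigcup_{\beta:(l,\beta)\le(k,\alpha)}\bar Q^l_\beta$ for every $l\ge k$ (these properties determine the cubes uniquely). $\bar Q^k_\alpha(\omega)$ denotes the closed cube obtained with $r_k=r_k(\omega)$, $R_k=R_k(\omega)$ for all $k$. *)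

theory Defs
  imports "HOL-Probability.Probability"
begin

definition doubling_constant :: "'a::metric_space itself \<Rightarrow> nat \<Rightarrow> bool" where
  "doubling_constant _ M \<longleftrightarrow>
     (\<forall>(x::'a) r::real. r > 0 \<longrightarrow>
        (\<exists>S. finite S \<and> card S \<le> M \<and> ball x r \<subseteq> (\<Union>y\<in>S. ball y (r / 2))))"

(* Extended-real valued, so that the distance to the empty set is infinity; the library's
   infdist and setdist are 0 there. *)
definition edist_set :: "'a::metric_space \<Rightarrow> 'a set \<Rightarrow> ereal" where
  "edist_set x A = (INF a\<in>A. ereal (dist x a))"

definition eps_boundary :: "real \<Rightarrow> 'a::metric_space set \<Rightarrow> 'a set" where
  "eps_boundary \<epsilon> A =
     {x \<in> A. edist_set x (- A) < ereal \<epsilon>} \<union> {x \<in> - A. edist_set x A < ereal \<epsilon>}"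

(* N k is the index set of the points of generation k; only the values z k \<alpha> with
   \<alpha> \<in> N k are meaningful.  The last clause says min_\<alpha> d(x, z k \<alpha>) < \<delta>^k. *)
definition dyadic_points ::
    "real \<Rightarrow> (int \<Rightarrow> nat set) \<Rightarrow> (int \<Rightarrow> nat \<Rightarrow> 'a::metric_space) \<Rightarrow> bool" where
  "dyadic_points \<delta> N z \<longleftrightarrow>
     (if bounded (UNIV :: 'a set) then \<exists>n::int \<Rightarrow> nat. \<forall>k. N k = {0..n k} else \<forall>k. N k = UNIV) \<and>
     (\<forall>k. z k ` N k \<subseteq> z (k + 1) ` N (k + 1)) \<and>
     (\<forall>k. \<forall>\<alpha>\<in>N k. \<forall>\<beta>\<in>N k. \<alpha> \<noteq> \<beta> \<longrightarrow> dist (z k \<alpha>) (z k \<beta>) \<ge> \<delta> powi k) \<and>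
     (\<forall>k x. \<exists>\<alpha>\<in>N k. dist x (z k \<alpha>) < \<delta> powi k)"

(* The outer radius R_k is 4 * r k throughout. *)
definition approx_cube ::
    "(int \<Rightarrow> nat set) \<Rightarrow> (int \<Rightarrow> nat \<Rightarrow> 'a::metric_space) \<Rightarrow> (int \<Rightarrow> real) \<Rightarrow> int \<Rightarrow> nat \<Rightarrow> 'a set" where
  "approx_cube N z r k \<alpha> =
     ball (z k \<alpha>) (r k) \<union>
     (ball (z k \<alpha>) (4 * r k) -
        ((\<Union>\<theta>\<in>{\<theta> \<in> N k. \<theta> \<noteq> \<alpha>}. ball (z k \<theta>) (r k)) \<union>
         (\<Union>\<theta>\<in>{\<theta> \<in> N k. \<theta> < \<alpha>}. ball (z k \<theta>) (4 * r k))))"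

definition cube_child ::
    "(int \<Rightarrow> nat set) \<Rightarrow> (int \<Rightarrow> nat \<Rightarrow> 'a::metric_space) \<Rightarrow> (int \<Rightarrow> real) \<Rightarrow>
     int \<times> nat \<Rightarrow> int \<times> nat \<Rightarrow> bool" where
  "cube_child N z r = (\<lambda>(l, \<beta>) (k, \<alpha>).
     l = k + 1 \<and> \<beta> \<in> N l \<and> \<alpha> \<in> N k \<and> z l \<beta> \<in> approx_cube N z r k \<alpha>)"

definition cube_le ::
    "(int \<Rightarrow> nat set) \<Rightarrow> (int \<Rightarrow> nat \<Rightarrow> 'a::metric_space) \<Rightarrow> (int \<Rightarrow> real) \<Rightarrow>
     int \<times> nat \<Rightarrow> int \<times> nat \<Rightarrow> bool" where
  "cube_le N z r = (cube_child N z r)\<^sup>*\<^sup>*"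

definition closed_cube ::
    "(int \<Rightarrow> nat set) \<Rightarrow> (int \<Rightarrow> nat \<Rightarrow> 'a::metric_space) \<Rightarrow> (int \<Rightarrow> real) \<Rightarrow> int \<Rightarrow> nat \<Rightarrow> 'a set" where
  "closed_cube N z r k \<alpha> = closure {z l \<beta> | l \<beta>. \<beta> \<in> N l \<and> cube_le N z r (l, \<beta>) (k, \<alpha>)}"

definition dyadic_prob :: "real \<Rightarrow> (int \<Rightarrow> nat) measure" where
  "dyadic_prob \<delta> = (\<Pi>\<^sub>M k\<in>UNIV. uniform_count_measure {0..nat \<lfloor>1 / \<delta>\<rfloor>})"

definition random_radius :: "real \<Rightarrow> (int \<Rightarrow> nat) \<Rightarrow> int \<Rightarrow> real" where
  "random_radius \<delta> \<omega> k = 1 / 4 * (\<delta> powi k + real (\<omega> k) * \<delta> powi (k + 1))"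

definition random_closed_cube ::
    "real \<Rightarrow> (int \<Rightarrow> nat set) \<Rightarrow> (int \<Rightarrow> nat \<Rightarrow> 'a::metric_space) \<Rightarrow>
     int \<Rightarrow> nat \<Rightarrow> (int \<Rightarrow> nat) \<Rightarrow> 'a set" where
  "random_closed_cube \<delta> N z k \<alpha> \<omega> = closed_cube N z (random_radius \<delta> \<omega>) k \<alpha>"

definition C_const :: "nat \<Rightarrow> real" where
  "C_const M = 84 * real M ^ 8"

definition eta :: "nat \<Rightarrow> real \<Rightarrow> real" where
  "eta M \<delta> = 1 - ln (C_const M) / ln (1 / \<delta>)"

end

theory Submission imports Defs begin

text \<open>
  Let \<open>\<epsilon> \<le> \<delta>\<^sup>k\<^sup>+\<^sup>n\<close> and let \<open>x\<close> lie in the \<open>\<epsilon>\<close>-boundary of a cube of generation \<open>k\<close>. Then for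
  every \<open>l\<close> with \<open>k \<le> l < k + n\<close> there are two dyadic points of generation \<open>l + 1\<close> within
  \<open>4\<delta>\<^sup>l\<^sup>+\<^sup>1\<close> of \<open>x\<close>, one a descendant of the cube and the other not, so some approximated cube of
  generation \<open>l\<close> separates them. Hence one of the radii \<open>r\<^sub>l\<close>, \<open>R\<^sub>l\<close> is within \<open>4\<delta>\<^sup>l\<^sup>+\<^sup>1\<close> of the distance
  from \<open>x\<close> to one of the at most \<open>M\<^sup>3\<close> nearby dyadic points of generation \<open>l\<close>. This constrains the
  coordinate \<open>\<omega>\<^sub>l\<close> alone, to at most \<open>42M\<^sup>3\<close> values, so independence bounds the probability by
  \<open>(42M\<^sup>3\<delta>)\<^sup>n\<close>. The exponent \<open>\<eta>\<close> is such that \<open>\<delta> powr \<eta> = C\<delta>\<close>.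
\<close>

section \<open>Covering and counting in doubling spaces\<close>

lemma doubling_constant_iterate:
  fixes x :: "'a::metric_space"
  assumes "doubling_constant TYPE('a) M" and "r > 0"
  shows "\<exists>S. finite S \<and> card S \<le> M ^ j \<and> ball x r \<subseteq> (\<Union>y\<in>S. ball y (r / 2 ^ j))"
proof (induction j)
  case 0
  then show ?case by (intro exI[of _ "{x}"]) auto
next
  case (Suc j)
  then obtain S where S: "finite S" "card S \<le> M ^ j"
      "ball x r \<subseteq> (\<Union>y\<in>S. ball y (r / 2 ^ j))"
    by blast
  have "\<exists>T. finite T \<and> card T \<le> M \<and> ball y (r / 2 ^ j) \<subseteq> (\<Union>u\<in>T. ball u (r / 2 ^ j / 2))"
    for y :: 'a
    using assms(1)[unfolded doubling_constant_def, rule_format, of "r / 2 ^ j" y] \<open>r > 0\<close> by simp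
  then obtain T where T: "\<And>y. finite (T y)" "\<And>y. card (T y) \<le> M"
      "\<And>y::'a. ball y (r / 2 ^ j) \<subseteq> (\<Union>u\<in>T y. ball u (r / 2 ^ j / 2))"
    by metis
  have "card (\<Union>y\<in>S. T y) \<le> (\<Sum>y\<in>S. card (T y))"
    by (rule card_UN_le[OF S(1)])
  also have "\<dots> \<le> card S * M"
    using sum_bounded_above[of S "\<lambda>y. card (T y)" M] T(2) by simp
  also have "\<dots> \<le> M ^ Suc j"
    using mult_right_mono[OF S(2), of M] by (simp add: mult.commute)
  finally have "card (\<Union>y\<in>S. T y) \<le> M ^ Suc j" .
  moreover have "ball x r \<subseteq> (\<Union>u\<in>(\<Union>y\<in>S. T y). ball u (r / 2 ^ Suc j))"
  proof
    fix v assume "v \<in> ball x r"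
    then obtain y where "y \<in> S" "v \<in> ball y (r / 2 ^ j)" using S(3) by blast
    then obtain u where "u \<in> T y" "v \<in> ball u (r / 2 ^ j / 2)" using T(3) by blast
    moreover have "r / 2 ^ j / 2 = r / 2 ^ Suc j" by simp
    ultimately show "v \<in> (\<Union>u\<in>(\<Union>y\<in>S. T y). ball u (r / 2 ^ Suc j))"
      using \<open>y \<in> S\<close> by (auto simp: mult.commute)
  qed
  moreover have "finite (\<Union>y\<in>S. T y)" using S(1) T(1) by blast
  ultimately show ?case by blast
qed

text \<open>A ball of radius \<open>r / 2 ^ j\<close> contains at most one of the points, since any
  two points in it are less than twice that radius apart. Hence sending each point to the centre of
  a covering ball that contains it is injective.\<close>

lemma doubling_constant_separated:
  fixes f :: "'b \<Rightarrow> 'a::metric_space"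
  assumes "doubling_constant TYPE('a) M" and "r > 0"
    and sep: "\<And>\<alpha> \<beta>. \<alpha> \<in> I \<Longrightarrow> \<beta> \<in> I \<Longrightarrow> \<alpha> \<noteq> \<beta> \<Longrightarrow> dist (f \<alpha>) (f \<beta>) \<ge> 2 * (r / 2 ^ j)"
    and near: "\<And>\<alpha>. \<alpha> \<in> I \<Longrightarrow> dist x (f \<alpha>) < r"
  shows "finite I \<and> card I \<le> M ^ j"
proof -
  obtain S where S: "finite S" "card S \<le> M ^ j" "ball x r \<subseteq> (\<Union>y\<in>S. ball y (r / 2 ^ j))"
    using doubling_constant_iterate[OF assms(1,2)] by blast
  have "\<forall>\<alpha>\<in>I. \<exists>y\<in>S. dist y (f \<alpha>) < r / 2 ^ j"
    using S(3) near by (fastforce simp: subset_iff)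
  then obtain g where g: "\<And>\<alpha>. \<alpha> \<in> I \<Longrightarrow> g \<alpha> \<in> S \<and> dist (g \<alpha>) (f \<alpha>) < r / 2 ^ j"
    by metis
  have "inj_on g I"
  proof (rule inj_onI, rule ccontr)
    fix \<alpha> \<beta> assume ab: "\<alpha> \<in> I" "\<beta> \<in> I" "g \<alpha> = g \<beta>" "\<alpha> \<noteq> \<beta>"
    have "dist (f \<alpha>) (f \<beta>) \<le> dist (g \<alpha>) (f \<alpha>) + dist (g \<alpha>) (f \<beta>)"
      by (metis dist_commute dist_triangle)
    with g[OF ab(1)] g[OF ab(2)] sep[OF ab(1,2,4)] ab(3) show False by simp
  qed
  moreover have "g ` I \<subseteq> S" using g by blast
  ultimately show ?thesis
    using S(1,2) by (meson card_inj_on_le finite_imageD finite_subset le_trans)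
qed

text \<open>The numbers counted lie between \<open>\<lceil>a - h\<rceil>\<close> and
  \<open>\<lfloor>a + h\<rfloor>\<close>; \<open>h \<ge> 0\<close> keeps the bound valid when this
  range is empty and \<open>nat\<close> truncates.\<close>

lemma card_nat_near:
  fixes a h :: real
  assumes "h \<ge> 0"
  shows "finite {n::nat. \<bar>real n - a\<bar> < h} \<and> real (card {n::nat. \<bar>real n - a\<bar> < h}) \<le> 2 * h + 1"
proof -
  let ?A = "{n::nat. \<bar>real n - a\<bar> < h}"
  have sub: "int ` ?A \<subseteq> {\<lceil>a - h\<rceil>..\<lfloor>a + h\<rfloor>}"
    by (auto simp: ceiling_le_iff le_floor_iff abs_less_iff)
  have "finite (int ` ?A)" using sub by (rule finite_subset) simp
  then have fin: "finite ?A" by (rule finite_imageD) simp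
  have "card ?A = card (int ` ?A)" by (simp add: card_image)
  also have "\<dots> \<le> card {\<lceil>a - h\<rceil>..\<lfloor>a + h\<rfloor>}" by (rule card_mono[OF _ sub]) simp
  finally have "real (card ?A) \<le> real (nat (\<lfloor>a + h\<rfloor> + 1 - \<lceil>a - h\<rceil>))" by simp
  also have "\<dots> \<le> 2 * h + 1"
    using assms of_int_floor_le[of "a + h"] le_of_int_ceiling[of "a - h"]
    by linarith
  finally show ?thesis using fin by blast
qed

section \<open>Boundaries, approximated cubes and closed cubes\<close>

lemma edist_set_less_iff: "edist_set x A < ereal \<epsilon> \<longleftrightarrow> (\<exists>a\<in>A. dist x a < \<epsilon>)"
  by (simp add: edist_set_def INF_less_iff)

text \<open>A point has distance 0 from any set containing it, so for positive
  \<open>\<epsilon>\<close> the two halves of the definition merge into one condition symmetric in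
  \<open>A\<close> and its complement.\<close>

lemma eps_boundary_iff:
  assumes "\<epsilon> > 0"
  shows "x \<in> eps_boundary \<epsilon> A \<longleftrightarrow> (\<exists>a\<in>A. dist x a < \<epsilon>) \<and> (\<exists>a\<in>-A. dist x a < \<epsilon>)"
  using assms by (auto simp: eps_boundary_def edist_set_less_iff intro: bexI[of _ x])

lemma approx_cube_subset_ball:
  assumes "r k \<ge> 0" shows "approx_cube N z r k \<alpha> \<subseteq> ball (z k \<alpha>) (4 * r k)"
  using assms by (auto simp: approx_cube_def)

text \<open>An approximated cube is a Boolean combination of the balls of radii \<open>r k\<close>
  and \<open>4 * r k\<close> about the points of generation \<open>k\<close>, so points that no such
  ball distinguishes lie in the same approximated cubes.\<close>

lemma approx_cube_separation:
  assumes "\<gamma> \<in> N k" "p \<in> approx_cube N z r k \<gamma>" "q \<notin> approx_cube N z r k \<gamma>"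
  shows "\<exists>\<theta>\<in>N k. \<exists>\<rho>\<in>{r k, 4 * r k}. (p \<in> ball (z k \<theta>) \<rho>) \<noteq> (q \<in> ball (z k \<theta>) \<rho>)"
proof (rule ccontr)
  assume "\<not> ?thesis"
  then have "\<And>\<theta>. \<theta> \<in> N k \<Longrightarrow> (p \<in> ball (z k \<theta>) (r k)) = (q \<in> ball (z k \<theta>) (r k))"
    and "\<And>\<theta>. \<theta> \<in> N k \<Longrightarrow> (p \<in> ball (z k \<theta>) (4 * r k)) = (q \<in> ball (z k \<theta>) (4 * r k))"
    by blast+
  with assms show False
    unfolding approx_cube_def by blast
qed

text \<open>An open ball meets a closure iff it meets the set itself. The right-hand side quantifies
  over countably many indices only, which also serves measurability.\<close>

lemma closed_cube_meets_ball_iff: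
  "(\<exists>y\<in>closed_cube N z r k \<alpha>. dist x y < \<epsilon>) \<longleftrightarrow>
   (\<exists>l \<beta>. \<beta> \<in> N l \<and> cube_le N z r (l, \<beta>) (k, \<alpha>) \<and> dist x (z l \<beta>) < \<epsilon>)" (is "?L \<longleftrightarrow> ?R")
proof -
  let ?D = "{z l \<beta> | l \<beta>. \<beta> \<in> N l \<and> cube_le N z r (l, \<beta>) (k, \<alpha>)}"
  have "?L \<longleftrightarrow> ball x \<epsilon> \<inter> closure ?D \<noteq> {}" by (auto simp: closed_cube_def)
  also have "\<dots> \<longleftrightarrow> ball x \<epsilon> \<inter> ?D \<noteq> {}"
    by (simp add: open_Int_closure_eq_empty)
  also have "\<dots> \<longleftrightarrow> ?R" by (fastforce simp: disjoint_iff)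
  finally show ?thesis .
qed

section \<open>Properties of the dyadic points\<close>

locale dyadic_grid =
  fixes \<delta> :: real and N :: "int \<Rightarrow> nat set" and z :: "int \<Rightarrow> nat \<Rightarrow> 'a::metric_space"
  assumes delta_pos: "0 < \<delta>" and delta_small: "\<delta> \<le> 1 / 3"
    and points: "dyadic_points \<delta> N z"
begin

lemma powi_Suc: "\<delta> powi (l + 1) = \<delta> * \<delta> powi l"
  using delta_pos by (simp add: power_int_add)

lemma powi_pos: "\<delta> powi l > 0"
  using delta_pos by simp

lemma points_nested: "\<beta> \<in> N k \<Longrightarrow> \<exists>\<beta>'\<in>N (k + 1). z (k + 1) \<beta>' = z k \<beta>"
  using points unfolding dyadic_points_def by (metis (no_types, lifting) image_iff subsetD)

lemma points_separated:
  "\<alpha> \<in> N k \<Longrightarrow> \<beta> \<in> N k \<Longrightarrow> \<alpha> \<noteq> \<beta> \<Longrightarrow> dist (z k \<alpha>) (z k \<beta>) \<ge> \<delta> powi k"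
  using points unfolding dyadic_points_def by blast

lemma points_cover: "\<exists>\<alpha>\<in>N k. dist x (z k \<alpha>) < \<delta> powi k"
  using points unfolding dyadic_points_def by blast

lemma points_dense:
  assumes "e > 0"
  shows "\<exists>m\<ge>l. \<exists>\<beta>\<in>N m. dist x (z m \<beta>) < e"
proof -
  obtain n where n: "\<delta> ^ n < e"
    using real_arch_pow_inv[OF assms, of \<delta>] delta_small by auto
  define m where "m = max l (int n)"
  obtain \<beta> where \<beta>: "\<beta> \<in> N m" "dist x (z m \<beta>) < \<delta> powi m" using points_cover by blast
  have "\<delta> powi m \<le> \<delta> powi (int n)"
    using delta_pos delta_small by (intro power_int_decreasing) (auto simp: m_def)
  then show ?thesis using n \<beta> by (intro exI[of _ m]) (auto simp: m_def intro!: bexI[of _ \<beta>])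
qed

text \<open>The complement of a closed cube is open, and dyadic points of arbitrarily fine
  generations are dense. The bound \<open>l\<close> is free, so the witness can be required to have
  an ancestor in a prescribed generation.\<close>

lemma closed_cube_compl_meets_ball_iff:
  "(\<exists>y\<in>- closed_cube N z r k \<alpha>. dist x y < \<epsilon>) \<longleftrightarrow>
   (\<exists>m\<ge>l. \<exists>\<beta>\<in>N m. z m \<beta> \<notin> closed_cube N z r k \<alpha> \<and> dist x (z m \<beta>) < \<epsilon>)"
proof
  assume "\<exists>y\<in>- closed_cube N z r k \<alpha>. dist x y < \<epsilon>"
  then obtain y where y: "y \<in> ball x \<epsilon> - closed_cube N z r k \<alpha>" by auto
  have "open (ball x \<epsilon> - closed_cube N z r k \<alpha>)"
    by (intro open_Diff) (auto simp: closed_cube_def)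
  then obtain e where e: "e > 0" "ball y e \<subseteq> ball x \<epsilon> - closed_cube N z r k \<alpha>"
    using y openE by blast
  obtain m \<beta> where "m \<ge> l" "\<beta> \<in> N m" "dist y (z m \<beta>) < e" using points_dense[OF e(1)] by blast
  moreover from this e(2) have "z m \<beta> \<in> ball x \<epsilon> - closed_cube N z r k \<alpha>" by auto
  ultimately show "\<exists>m\<ge>l. \<exists>\<beta>\<in>N m. z m \<beta> \<notin> closed_cube N z r k \<alpha> \<and> dist x (z m \<beta>) < \<epsilon>"
    by auto
qed auto

end

section \<open>The order on cubes for one fixed choice of radii\<close>

locale dyadic_cubes = dyadic_grid +
  fixes r :: "int \<Rightarrow> real"
  assumes radius_lower: "r k \<ge> \<delta> powi k / 4" and radius_upper: "r k \<le> \<delta> powi k / 2"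
begin

lemma radius_pos: "r k > 0"
  using radius_lower[of k] powi_pos[of k] by simp

lemma approx_cube_cover: "\<exists>\<alpha>\<in>N k. x \<in> approx_cube N z r k \<alpha>"
proof (cases "\<exists>\<theta>\<in>N k. x \<in> ball (z k \<theta>) (r k)")
  case True
  then show ?thesis by (auto simp: approx_cube_def)
next
  case False
  \<comment> \<open>The outer balls cover the space because
    \<open>4 * r k \<ge> \<delta> powi k\<close>. Only outer balls of smaller index are removed, so
    outside all inner balls the least index wins.\<close>
  let ?P = "\<lambda>\<alpha>. \<alpha> \<in> N k \<and> x \<in> ball (z k \<alpha>) (4 * r k)"
  obtain \<beta> where "\<beta> \<in> N k" "dist x (z k \<beta>) < \<delta> powi k" using points_cover by blast
  then have "?P \<beta>" using radius_lower[of k] by (auto simp: dist_commute)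
  then have "?P (LEAST \<alpha>. ?P \<alpha>)" by (rule LeastI)
  moreover have "\<And>\<theta>. ?P \<theta> \<Longrightarrow> \<not> \<theta> < (LEAST \<alpha>. ?P \<alpha>)" using not_less_Least by blast
  ultimately show ?thesis
    using False unfolding approx_cube_def by blast
qed

lemma cube_le_level: "cube_le N z r p q \<Longrightarrow> fst q \<le> fst p"
  unfolding cube_le_def
  by (induction rule: rtranclp_induct) (auto simp: cube_child_def)

lemma cube_le_index: "cube_le N z r p q \<Longrightarrow> snd p \<in> N (fst p) \<Longrightarrow> snd q \<in> N (fst q)"
  unfolding cube_le_def
  by (induction rule: rtranclp_induct) (auto simp: cube_child_def)

lemma cube_le_trans: "cube_le N z r p q \<Longrightarrow> cube_le N z r q s \<Longrightarrow> cube_le N z r p s"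
  unfolding cube_le_def by (rule rtranclp_trans)

text \<open>Each child step changes the generation by exactly one, so a chain visits every
  generation between its ends.\<close>

lemma cube_le_intermediate:
  assumes "cube_le N z r p q" "fst q \<le> l" "l \<le> fst p"
  shows "\<exists>\<gamma>. cube_le N z r p (l, \<gamma>) \<and> cube_le N z r (l, \<gamma>) q"
  using assms unfolding cube_le_def
proof (induction rule: rtranclp_induct)
  case base
  then have "p = (l, snd p)" by (simp add: prod_eq_iff)
  then show ?case by (metis rtranclp.rtrancl_refl)
next
  case (step y w)
  have lev: "fst y = fst w + 1" using step(2) by (auto simp: cube_child_def)
  show ?case
  proof (cases "fst y \<le> l")
    case True
    then show ?thesis using step by (meson rtranclp.rtrancl_into_rtrancl)
  next
    case False
    then have "w = (l, snd w)" using lev step(4) by (simp add: prod_eq_iff)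
    then show ?thesis
      using step(1,2) by (metis rtranclp.rtrancl_into_rtrancl rtranclp.rtrancl_refl)
  qed
qed

text \<open>A step into generation \<open>k\<close> moves by less than
  \<open>2 * \<delta> powi k\<close>, which is at most
  \<open>3 * (\<delta> powi k - \<delta> powi (k + 1))\<close> because
  \<open>\<delta> \<le> 1 / 3\<close>. These differences telescope along the chain.\<close>

lemma cube_le_dist:
  assumes "cube_le N z r p q"
  shows "dist (z (fst p) (snd p)) (z (fst q) (snd q)) \<le> 3 * (\<delta> powi fst q - \<delta> powi fst p)"
  using assms unfolding cube_le_def
proof (induction rule: rtranclp_induct)
  case base
  then show ?case by simp
next
  case (step y w)
  have lev: "fst y = fst w + 1" and mem: "z (fst y) (snd y) \<in> approx_cube N z r (fst w) (snd w)"
    using step(2) by (auto simp: cube_child_def)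
  have "z (fst y) (snd y) \<in> ball (z (fst w) (snd w)) (4 * r (fst w))"
    using approx_cube_subset_ball[of r "fst w" N z "snd w"] radius_pos[of "fst w"] mem by auto
  then have "dist (z (fst y) (snd y)) (z (fst w) (snd w)) < 2 * \<delta> powi fst w"
    using radius_upper[of "fst w"] by (simp add: dist_commute)
  moreover have "\<delta> powi fst y \<le> \<delta> powi fst w / 3"
    unfolding lev powi_Suc using mult_right_mono[OF delta_small, of "\<delta> powi fst w"] powi_pos
    by (simp add: less_imp_le)
  ultimately show ?case
    using step(3) dist_triangle[of "z (fst p) (snd p)" "z (fst w) (snd w)" "z (fst y) (snd y)"]
    by simp
qed

lemma ancestor_exists:
  assumes "l \<le> m" "\<beta> \<in> N m"
  shows "\<exists>\<gamma>\<in>N l. cube_le N z r (m, \<beta>) (l, \<gamma>)"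
  using assms(1)
proof (induction rule: int_le_induct)
  case base
  then show ?case using assms(2) by (auto simp: cube_le_def)
next
  case (step i)
  then obtain \<gamma> where g: "\<gamma> \<in> N i" "cube_le N z r (m, \<beta>) (i, \<gamma>)" by blast
  obtain \<alpha> where a: "\<alpha> \<in> N (i - 1)" "z i \<gamma> \<in> approx_cube N z r (i - 1) \<alpha>"
    using approx_cube_cover by blast
  have "cube_child N z r (i, \<gamma>) (i - 1, \<alpha>)" using g a by (simp add: cube_child_def)
  then show ?case using g(2) a(1) unfolding cube_le_def
    by (meson rtranclp.rtrancl_into_rtrancl)
qed

text \<open>A dyadic point reappears in the next generation and lies in the inner ball about itself,
  so its copy is a child of the original.\<close>

lemma descendant_exists:
  assumes "m \<le> m'" "\<beta> \<in> N m"
  shows "\<exists>\<beta>'\<in>N m'. z m' \<beta>' = z m \<beta> \<and> cube_le N z r (m', \<beta>') (m, \<beta>)"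
  using assms(1)
proof (induction rule: int_ge_induct)
  case base
  then show ?case using assms(2) by (auto simp: cube_le_def)
next
  case (step i)
  then obtain \<gamma> where g: "\<gamma> \<in> N i" "z i \<gamma> = z m \<beta>" "cube_le N z r (i, \<gamma>) (m, \<beta>)" by blast
  obtain \<gamma>' where g': "\<gamma>' \<in> N (i + 1)" "z (i + 1) \<gamma>' = z i \<gamma>"
    using points_nested[OF g(1)] by blast
  have "cube_child N z r (i + 1, \<gamma>') (i, \<gamma>)"
    using g g' radius_pos[of i] by (simp add: cube_child_def approx_cube_def)
  then show ?case using g g' unfolding cube_le_def
    by (metis converse_rtranclp_into_rtranclp)
qed

text \<open>Take \<open>\<gamma>\<close> on a chain from a dyadic point near \<open>x\<close> up to
  \<open>(k, \<alpha>)\<close>. Every child of \<open>(l, \<gamma>)\<close> is below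
  \<open>(k, \<alpha>)\<close>, so the ancestor in generation \<open>l + 1\<close> of a nearby point
  outside the closed cube is not such a child.\<close>

lemma eps_boundary_separated:
  assumes "\<epsilon> > 0" "\<epsilon> \<le> \<delta> powi (l + 1)" "k \<le> l"
    and x: "x \<in> eps_boundary \<epsilon> (closed_cube N z r k \<alpha>)"
  shows "\<exists>\<gamma>\<in>N l. \<exists>p\<in>approx_cube N z r l \<gamma>. \<exists>q. q \<notin> approx_cube N z r l \<gamma> \<and>
           dist x p < 4 * \<delta> powi (l + 1) \<and> dist x q < 4 * \<delta> powi (l + 1)"
proof -
  \<comment> \<open>The constant 4 is 1 + 3: the point \<open>z m \<gamma>\<close> is within
    \<open>\<epsilon> \<le> \<delta> powi (l + 1)\<close> of \<open>x\<close>, and its ancestor is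
    less than \<open>3 * \<delta> powi (l + 1)\<close> further away.\<close>
  have near: "dist x (z (l + 1) \<beta>) < 4 * \<delta> powi (l + 1)"
    if "cube_le N z r (m, \<gamma>) (l + 1, \<beta>)" "dist x (z m \<gamma>) < \<epsilon>" for m \<gamma> \<beta>
    using that(2) cube_le_dist[OF that(1)] assms(2) powi_pos[of m]
      dist_triangle[of x "z (l + 1) \<beta>" "z m \<gamma>"] by simp
  obtain m \<beta> where b: "\<beta> \<in> N m" "cube_le N z r (m, \<beta>) (k, \<alpha>)" "dist x (z m \<beta>) < \<epsilon>"
    using x unfolding eps_boundary_iff[OF assms(1)] closed_cube_meets_ball_iff by blast
  \<comment> \<open>The generation \<open>m\<close> may be coarser than \<open>l + 1\<close>; the
    same point is then relabelled in generation \<open>l + 1\<close>, so that the chain passes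
    through that generation.\<close>
  obtain \<beta>' where b': "\<beta>' \<in> N (max m (l + 1))" "z (max m (l + 1)) \<beta>' = z m \<beta>"
      "cube_le N z r (max m (l + 1), \<beta>') (m, \<beta>)"
    using descendant_exists[of m "max m (l + 1)" \<beta>] b(1) by auto
  obtain p where p: "cube_le N z r (max m (l + 1), \<beta>') (l + 1, p)" "cube_le N z r (l + 1, p) (k, \<alpha>)"
    using cube_le_intermediate[OF cube_le_trans[OF b'(3) b(2)], of "l + 1"] assms(3) by auto
  obtain \<gamma> where g: "cube_le N z r (l + 1, p) (l, \<gamma>)" "cube_le N z r (l, \<gamma>) (k, \<alpha>)"
    using cube_le_intermediate[OF p(2), of l] assms(3) by auto
  have pN: "p \<in> N (l + 1)" using cube_le_index[OF p(1)] b'(1) by simp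
  have gN: "\<gamma> \<in> N l" using cube_le_index[OF g(1)] pN by simp
  \<comment> \<open>A chain from generation \<open>l + 1\<close> to generation \<open>l\<close> is a
    single step, so the order relation yields membership in the approximated cube.\<close>
  from g(1) obtain w where "cube_le N z r (l + 1, p) w" "cube_child N z r w (l, \<gamma>)"
    unfolding cube_le_def by (cases rule: rtranclp.cases) auto
  moreover have "w = (l + 1, p)"
    using calculation(1)[unfolded cube_le_def]
  proof (cases rule: converse_rtranclpE)
    case (step y)
    then have "fst w \<le> fst y" using cube_le_level[unfolded cube_le_def] by blast
    with step(1) calculation(2) show ?thesis by (auto simp: cube_child_def)
  qed simp
  ultimately have pA: "z (l + 1) p \<in> approx_cube N z r l \<gamma>" by (simp add: cube_child_def)
  obtain m2 \<beta>2 where c: "m2 \<ge> l + 1" "\<beta>2 \<in> N m2" "z m2 \<beta>2 \<notin> closed_cube N z r k \<alpha>"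
      "dist x (z m2 \<beta>2) < \<epsilon>"
    using x closed_cube_compl_meets_ball_iff[where l = "l + 1" and r = r]
    by (auto simp: eps_boundary_iff[OF assms(1)])
  have notle: "\<not> cube_le N z r (m2, \<beta>2) (k, \<alpha>)"
  proof
    assume "cube_le N z r (m2, \<beta>2) (k, \<alpha>)"
    then have "z m2 \<beta>2 \<in> closed_cube N z r k \<alpha>"
      unfolding closed_cube_def using c(2) by (intro subsetD[OF closure_subset]) blast
    with c(3) show False by blast
  qed
  obtain q where q: "q \<in> N (l + 1)" "cube_le N z r (m2, \<beta>2) (l + 1, q)"
    using ancestor_exists[OF c(1,2)] by blast
  have qA: "z (l + 1) q \<notin> approx_cube N z r l \<gamma>"
  proof
    assume "z (l + 1) q \<in> approx_cube N z r l \<gamma>"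
    then have "cube_child N z r (l + 1, q) (l, \<gamma>)" using q(1) gN by (simp add: cube_child_def)
    then have "cube_le N z r (l + 1, q) (l, \<gamma>)" by (simp add: cube_le_def)
    with q(2) g(2) notle show False by (meson cube_le_trans)
  qed
  show ?thesis
    using gN pA qA near[OF p(1)] b'(2) b(3) near[OF q(2) c(4)] by metis
qed

end

section \<open>Unfavourable values of a single coordinate\<close>

context dyadic_grid
begin

text \<open>The factors \<open>1 / 4\<close> and \<open>1\<close> give the inner and the outer
  radius. The set does not depend on \<open>\<omega>\<close>, so the conditions on different
  coordinates are independent.\<close>

definition bad_offsets :: "'a \<Rightarrow> int \<Rightarrow> nat set" where
  "bad_offsets x l = {w \<in> {0..nat \<lfloor>1 / \<delta>\<rfloor>}. \<exists>\<theta>\<in>N l. \<exists>c\<in>{1 / 4, 1}.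
     \<bar>dist (z l \<theta>) x - c * (\<delta> powi l + real w * \<delta> powi (l + 1))\<bar> < 4 * \<delta> powi (l + 1)}"

lemma offset_bound:
  assumes "w \<le> nat \<lfloor>1 / \<delta>\<rfloor>"
  shows "real w * \<delta> powi (l + 1) \<le> \<delta> powi l"
proof -
  have "real w \<le> 1 / \<delta>" using assms delta_pos by (simp add: le_nat_floor le_floor_iff nat_le_iff le_nat_iff)
  then have "real w * \<delta> \<le> 1" using delta_pos by (simp add: field_simps)
  then have "real w * \<delta> * \<delta> powi l \<le> 1 * \<delta> powi l"
    by (rule mult_right_mono) (simp add: powi_pos less_imp_le)
  then show ?thesis by (simp add: powi_Suc mult.assoc)
qed

lemma dyadic_cubes_random_radius:
  assumes "\<And>k. \<omega> k \<le> nat \<lfloor>1 / \<delta>\<rfloor>"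
  shows "dyadic_cubes \<delta> N z (random_radius \<delta> \<omega>)"
proof unfold_locales
  fix k
  show "random_radius \<delta> \<omega> k \<ge> \<delta> powi k / 4"
    using powi_pos[of "k + 1"] by (simp add: random_radius_def)
  show "random_radius \<delta> \<omega> k \<le> \<delta> powi k / 2"
    using offset_bound[OF assms, of k k] by (simp add: random_radius_def)
qed

lemma bad_offsets_eps_boundary:
  assumes w: "\<And>k. \<omega> k \<le> nat \<lfloor>1 / \<delta>\<rfloor>"
    and "\<epsilon> > 0" "\<epsilon> \<le> \<delta> powi (l + 1)" "k \<le> l"
    and x: "x \<in> eps_boundary \<epsilon> (random_closed_cube \<delta> N z k \<alpha> \<omega>)"
  shows "\<omega> l \<in> bad_offsets x l"
proof -
  interpret dyadic_cubes \<delta> N z "random_radius \<delta> \<omega>"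
    by (rule dyadic_cubes_random_radius[OF w])
  obtain \<gamma> p q where sep: "\<gamma> \<in> N l" "p \<in> approx_cube N z (random_radius \<delta> \<omega>) l \<gamma>"
      "q \<notin> approx_cube N z (random_radius \<delta> \<omega>) l \<gamma>"
      and pq: "dist x p < 4 * \<delta> powi (l + 1)" "dist x q < 4 * \<delta> powi (l + 1)"
    using eps_boundary_separated[OF assms(2-4) x[unfolded random_closed_cube_def]] by blast
  obtain \<theta> \<rho> where t: "\<theta> \<in> N l" "\<rho> \<in> {random_radius \<delta> \<omega> l, 4 * random_radius \<delta> \<omega> l}"
      "(p \<in> ball (z l \<theta>) \<rho>) \<noteq> (q \<in> ball (z l \<theta>) \<rho>)"
    using approx_cube_separation[OF sep] by blast
  have "\<bar>dist (z l \<theta>) x - dist (z l \<theta>) u\<bar> \<le> dist x u" for u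
    using dist_triangle[of "z l \<theta>" u x] dist_triangle[of "z l \<theta>" x u] dist_commute[of u x]
    by linarith
  from this[of p] this[of q] pq
  have "\<bar>dist (z l \<theta>) x - dist (z l \<theta>) p\<bar> < 4 * \<delta> powi (l + 1)"
    and "\<bar>dist (z l \<theta>) x - dist (z l \<theta>) q\<bar> < 4 * \<delta> powi (l + 1)" by linarith+
  \<comment> \<open>Exactly one of \<open>p\<close> and \<open>q\<close> is in the ball, so
    \<open>\<rho>\<close> lies between their distances to the centre, and both of these are close to
    that of \<open>x\<close>.\<close>
  moreover have "dist (z l \<theta>) p < \<rho> \<and> \<rho> \<le> dist (z l \<theta>) q \<or>
      dist (z l \<theta>) q < \<rho> \<and> \<rho> \<le> dist (z l \<theta>) p"
    using t(3) by (auto simp: not_less)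
  ultimately have "\<bar>dist (z l \<theta>) x - \<rho>\<bar> < 4 * \<delta> powi (l + 1)" by linarith
  moreover obtain c where "c \<in> {1 / 4, 1}" "\<rho> = c * (\<delta> powi l + real (\<omega> l) * \<delta> powi (l + 1))"
    using t(2) that[of "1 / 4"] that[of 1] by (auto simp: random_radius_def)
  moreover have "\<omega> l \<in> {0..nat \<lfloor>1 / \<delta>\<rfloor>}" using w by simp
  ultimately show ?thesis
    using t(1) unfolding bad_offsets_def by blast
qed

lemma card_bad_offsets:
  assumes "doubling_constant TYPE('a) M" and small: "\<delta> \<le> 1 / 4"
  shows "card (bad_offsets x l) \<le> 42 * M ^ 3"
proof -
  \<comment> \<open>Relevant centres are closer to \<open>x\<close> than \<open>2 * \<delta> powi l
    + 4 * \<delta> powi (l + 1) \<le> 3 * \<delta> powi l\<close>. The radius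
    \<open>4 * \<delta> powi l\<close> is \<open>2 ^ 3\<close> times half the separation, so three
    halvings suffice.\<close>
  define T where "T = {\<theta> \<in> N l. dist x (z l \<theta>) < 4 * \<delta> powi l}"
  have T: "finite T \<and> card T \<le> M ^ 3"
    by (rule doubling_constant_separated[OF assms(1), where r = "4 * \<delta> powi l" and f = "z l" and x = x])
       (auto simp: T_def powi_pos points_separated)
  \<comment> \<open>Increasing \<open>w\<close> by one changes the radius by
    \<open>c * \<delta> powi (l + 1)\<close>; dividing by this confines \<open>w\<close> to distance
    less than \<open>4 / c\<close> from \<open>a c \<theta>\<close>.\<close>
  define a where "a c \<theta> = (dist (z l \<theta>) x / c - \<delta> powi l) / \<delta> powi (l + 1)" for c \<theta>
  define V where "V c \<theta> = {w::nat. \<bar>real w - a c \<theta>\<bar> < 4 / c}" for c \<theta>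
  have V: "finite (V c \<theta>) \<and> real (card (V c \<theta>)) \<le> 8 / c + 1" if "c > 0" for c \<theta>
    using card_nat_near[of "4 / c" "a c \<theta>"] that by (simp add: V_def)
  have "bad_offsets x l \<subseteq> (\<Union>\<theta>\<in>T. V (1 / 4) \<theta> \<union> V 1 \<theta>)"
  proof
    fix w assume "w \<in> bad_offsets x l"
    then obtain \<theta> c where w: "w \<in> {0..nat \<lfloor>1 / \<delta>\<rfloor>}" "\<theta> \<in> N l" and c: "c \<in> {1 / 4, 1::real}"
      and h: "\<bar>dist (z l \<theta>) x - c * (\<delta> powi l + real w * \<delta> powi (l + 1))\<bar> < 4 * \<delta> powi (l + 1)"
      unfolding bad_offsets_def by blast
    have "real w * \<delta> powi (l + 1) \<le> \<delta> powi l" using offset_bound w(1) by simp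
    moreover have "\<delta> powi (l + 1) \<le> \<delta> powi l / 4"
      unfolding powi_Suc using mult_right_mono[OF small, of "\<delta> powi l"] powi_pos
      by (simp add: less_imp_le)
    moreover have "c * (\<delta> powi l + real w * \<delta> powi (l + 1)) \<le> \<delta> powi l + real w * \<delta> powi (l + 1)"
      using c powi_pos[of l] powi_pos[of "l + 1"]
      by (intro mult_left_le_one_le) (auto intro: add_nonneg_nonneg)
    ultimately have "dist (z l \<theta>) x < 4 * \<delta> powi l" using h powi_pos[of l] by linarith
    then have "\<theta> \<in> T" using w(2) by (simp add: T_def dist_commute)
    have cp: "c > 0" using c by auto
    have eq: "dist (z l \<theta>) x - c * (\<delta> powi l + real w * \<delta> powi (l + 1))
        = (a c \<theta> - real w) * (c * \<delta> powi (l + 1))"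
    proof -
      have "a c \<theta> * \<delta> powi (l + 1) = dist (z l \<theta>) x / c - \<delta> powi l"
        unfolding a_def using delta_pos by simp
      then have "c * (a c \<theta> * \<delta> powi (l + 1)) = dist (z l \<theta>) x - c * \<delta> powi l"
        using cp by (simp add: right_diff_distrib)
      then show ?thesis by (simp add: algebra_simps)
    qed
    have "\<bar>a c \<theta> - real w\<bar> * (c * \<delta> powi (l + 1)) < (4 / c) * (c * \<delta> powi (l + 1))"
      using h cp powi_pos[of "l + 1"] unfolding eq abs_mult by simp
    then have "w \<in> V c \<theta>"
      using cp powi_pos[of "l + 1"]
      by (simp add: V_def mult_less_cancel_right abs_minus_commute pos_less_divide_eq)
    with c \<open>\<theta> \<in> T\<close> show "w \<in> (\<Union>\<theta>\<in>T. V (1 / 4) \<theta> \<union> V 1 \<theta>)" by blast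
  qed
  then have "card (bad_offsets x l) \<le> card (\<Union>\<theta>\<in>T. V (1 / 4) \<theta> \<union> V 1 \<theta>)"
    using T V by (intro card_mono) auto
  also have "\<dots> \<le> (\<Sum>\<theta>\<in>T. card (V (1 / 4) \<theta> \<union> V 1 \<theta>))"
    using T by (intro card_UN_le) auto
  \<comment> \<open>Per centre, an interval of length 32 for the inner radius holds at most 33
    integers, and one of length 8 for the outer radius at most 9.\<close>
  also have "\<dots> \<le> (\<Sum>\<theta>\<in>T. 42)"
  proof (rule sum_mono)
    fix \<theta>
    have "card (V (1 / 4) \<theta>) \<le> 33" "card (V 1 \<theta>) \<le> 9"
      using V[of "1 / 4" \<theta>] V[of 1 \<theta>] by simp_all
    then show "card (V (1 / 4) \<theta> \<union> V 1 \<theta>) \<le> 42"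
      using card_Un_le[of "V (1 / 4) \<theta>" "V 1 \<theta>"] by linarith
  qed
  also have "\<dots> \<le> 42 * M ^ 3" using T by simp
  finally show ?thesis .
qed

section \<open>Measurability of the boundary event\<close>

lemma space_dyadic_prob: "\<omega> \<in> space (dyadic_prob \<delta>) \<Longrightarrow> \<omega> k \<le> nat \<lfloor>1 / \<delta>\<rfloor>"
  by (auto simp: dyadic_prob_def space_PiM space_uniform_count_measure PiE_iff)

text \<open>Every subset of the finite value space of a coordinate is measurable, so
  \<open>P\<close> may be arbitrary.\<close>

lemma pred_coordinate: "Measurable.pred (dyadic_prob \<delta>) (\<lambda>\<omega>. P (\<omega> k))"
proof -
  let ?U = "uniform_count_measure {0..nat \<lfloor>1 / \<delta>\<rfloor>}"
  have "(\<lambda>\<omega>. \<omega> k) \<in> dyadic_prob \<delta> \<rightarrow>\<^sub>M ?U"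
    unfolding dyadic_prob_def by (rule measurable_component_singleton) simp
  moreover have "Measurable.pred ?U P"
    by (auto simp: pred_def sets_uniform_count_measure space_uniform_count_measure)
  ultimately show ?thesis by (rule measurable_compose)
qed

text \<open>Being a child of \<open>q\<close> depends on \<open>\<omega>\<close> only through the
  coordinate \<open>fst q\<close>, so a constant sequence can replace \<open>\<omega>\<close> there.
  The order is then a union over chain lengths and intermediate pairs, both countable.\<close>

lemma pred_cube_le: "Measurable.pred (dyadic_prob \<delta>) (\<lambda>\<omega>. cube_le N z (random_radius \<delta> \<omega>) p q)"
proof -
  let ?R = "\<lambda>\<omega>. cube_child N z (random_radius \<delta> \<omega>)"
  have "?R \<omega> y q = cube_child N z (random_radius \<delta> (\<lambda>_. \<omega> (fst q))) y q" for \<omega> y q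
    by (auto simp: cube_child_def approx_cube_def random_radius_def split: prod.splits)
  then have child: "Measurable.pred (dyadic_prob \<delta>) (\<lambda>\<omega>. ?R \<omega> y q)" for y q
    using pred_coordinate[of "\<lambda>w. cube_child N z (random_radius \<delta> (\<lambda>_. w)) y q" "fst q"] by simp
  have "Measurable.pred (dyadic_prob \<delta>) (\<lambda>\<omega>. (?R \<omega> ^^ n) p q)" for n
  proof (induction n arbitrary: q)
    case 0
    then show ?case by simp
  next
    case (Suc n)
    have "(?R \<omega> ^^ Suc n) p q \<longleftrightarrow> (\<exists>y. (?R \<omega> ^^ n) p y \<and> ?R \<omega> y q)" for \<omega>
      by (auto simp: relcompp_apply)
    then show ?case
      using Suc child by (simp only:) (intro pred_intros_countable pred_intros_logic)
  qed
  then show ?thesis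
    unfolding cube_le_def rtranclp_power by (intro pred_intros_countable)
qed

lemma pred_cube_meets_ball:
  "Measurable.pred (dyadic_prob \<delta>) (\<lambda>\<omega>. \<exists>y\<in>random_closed_cube \<delta> N z k \<alpha> \<omega>. dist x y < \<epsilon>)"
  unfolding random_closed_cube_def closed_cube_meets_ball_iff
  by (intro pred_intros_countable pred_intros_logic pred_cube_le) auto

text \<open>For a closed set, membership means approximation at the countably many scales
  \<open>inverse (real (Suc n))\<close>.\<close>

lemma pred_mem_cube: "Measurable.pred (dyadic_prob \<delta>) (\<lambda>\<omega>. x \<in> random_closed_cube \<delta> N z k \<alpha> \<omega>)"
proof -
  have "x \<in> S \<longleftrightarrow> (\<forall>n. \<exists>y\<in>S. dist x y < inverse (real (Suc n)))" if "closed S" for S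
  proof
    assume "\<forall>n. \<exists>y\<in>S. dist x y < inverse (real (Suc n))"
    then have "\<forall>e>0. \<exists>y\<in>S. dist y x < e"
      by (metis dist_commute less_trans reals_Archimedean)
    then show "x \<in> S" using that by (simp add: closed_approachable)
  qed (auto intro!: bexI[of _ x])
  then have "x \<in> random_closed_cube \<delta> N z k \<alpha> \<omega> \<longleftrightarrow>
      (\<forall>n. \<exists>y\<in>random_closed_cube \<delta> N z k \<alpha> \<omega>. dist x y < inverse (real (Suc n)))" for \<omega>
    by (simp add: random_closed_cube_def closed_cube_def)
  then show ?thesis
    by (simp only:) (intro pred_intros_countable pred_cube_meets_ball)
qed

lemma pred_eps_boundary:
  assumes "\<epsilon> > 0"
  shows "Measurable.pred (dyadic_prob \<delta>)
    (\<lambda>\<omega>. x \<in> (\<Union>\<alpha>\<in>N k. eps_boundary \<epsilon> (random_closed_cube \<delta> N z k \<alpha> \<omega>)))"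
proof -
  \<comment> \<open>Dyadic points replace the possibly uncountable range of \<open>y\<close>; the
    starting generation 0 is an arbitrary choice.\<close>
  have compl: "(\<exists>y\<in>- random_closed_cube \<delta> N z k \<alpha> \<omega>. dist x y < \<epsilon>) \<longleftrightarrow>
      (\<exists>m \<beta>. m \<ge> 0 \<and> \<beta> \<in> N m \<and> z m \<beta> \<notin> random_closed_cube \<delta> N z k \<alpha> \<omega> \<and> dist x (z m \<beta>) < \<epsilon>)"
    for \<alpha> \<omega>
    using closed_cube_compl_meets_ball_iff[where l = 0] unfolding random_closed_cube_def by blast
  have "x \<in> (\<Union>\<alpha>\<in>N k. eps_boundary \<epsilon> (random_closed_cube \<delta> N z k \<alpha> \<omega>)) \<longleftrightarrow>
    (\<exists>\<alpha>. \<alpha> \<in> N k \<and> (\<exists>y\<in>random_closed_cube \<delta> N z k \<alpha> \<omega>. dist x y < \<epsilon>) \<and>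
      (\<exists>m \<beta>. m \<ge> 0 \<and> \<beta> \<in> N m \<and> z m \<beta> \<notin> random_closed_cube \<delta> N z k \<alpha> \<omega> \<and> dist x (z m \<beta>) < \<epsilon>))"
    for \<omega>
    unfolding UN_iff eps_boundary_iff[OF assms] compl by blast
  then show ?thesis
    by (simp only:)
       (intro pred_intros_countable pred_intros_logic pred_cube_meets_ball pred_mem_cube; simp)
qed

section \<open>Independence and the geometric probability bound\<close>

lemma prob_space_dyadic_prob: "prob_space (dyadic_prob \<delta>)"
  unfolding dyadic_prob_def by (intro prob_space_PiM prob_space_uniform_count_measure) auto

lemma prob_bad_offsets:
  assumes "doubling_constant TYPE('a) M" and small: "\<delta> \<le> 1 / 4"
  shows "{\<omega> \<in> space (dyadic_prob \<delta>). \<forall>l\<in>{k..<k + int n}. \<omega> l \<in> bad_offsets x l}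
           \<in> sets (dyadic_prob \<delta>)" (is "?E \<in> _")
    and "measure (dyadic_prob \<delta>)
           {\<omega> \<in> space (dyadic_prob \<delta>). \<forall>l\<in>{k..<k + int n}. \<omega> l \<in> bad_offsets x l}
           \<le> (42 * real M ^ 3 * \<delta>) ^ n"
proof -
  let ?W = "{0..nat \<lfloor>1 / \<delta>\<rfloor>}" and ?J = "{k..<k + int n}"
  let ?U = "\<lambda>_::int. uniform_count_measure ?W"
  show meas: "?E \<in> sets (dyadic_prob \<delta>)"
    unfolding pred_def[symmetric]
    by (intro pred_intros_finite pred_coordinate) simp
  interpret product_prob_space ?U UNIV
    by (intro product_prob_spaceI prob_space_uniform_count_measure) auto
  have sub: "bad_offsets x l \<subseteq> ?W" for l by (auto simp: bad_offsets_def)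
  \<comment> \<open>The event is a cylinder over the \<open>n\<close> coordinates in
    \<open>?J\<close>, so the product measure factorises.\<close>
  have "?E = emb UNIV ?J (Pi\<^sub>E ?J (bad_offsets x))"
    by (auto simp: dyadic_prob_def prod_emb_def space_PiM PiE_iff restrict_def)
  then have "measure (dyadic_prob \<delta>) ?E = (\<Prod>l\<in>?J. measure (?U l) (bad_offsets x l))"
    unfolding dyadic_prob_def
    using measure_PiM_emb[of ?J "bad_offsets x"] sub
    by (simp add: sets_uniform_count_measure)
  also have "\<dots> \<le> (\<Prod>l\<in>?J. 42 * real M ^ 3 * \<delta>)"
  proof (rule prod_mono, intro conjI measure_nonneg)
    fix l
    \<comment> \<open>A coordinate has
      \<open>\<lfloor>1 / \<delta>\<rfloor> + 1 \<ge> 1 / \<delta>\<close> equally likely values, so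
      each has probability at most \<open>\<delta>\<close>.\<close>
    have W: "1 / \<delta> \<le> real (card ?W)"
      using delta_pos by simp linarith
    then have "real (card ?W) > 0"
      using delta_pos less_le_trans[of 0 "1 / \<delta>"] by simp
    with W have "1 / real (card ?W) \<le> \<delta>"
      using delta_pos by (simp only: pos_divide_le_eq mult.commute)
    moreover have "real (card (bad_offsets x l)) \<le> 42 * real M ^ 3"
      using card_bad_offsets[OF assms, of x l]
      by (metis of_nat_le_iff of_nat_mult of_nat_numeral of_nat_power)
    ultimately have "real (card (bad_offsets x l)) * (1 / real (card ?W)) \<le> 42 * real M ^ 3 * \<delta>"
      by (intro mult_mono) auto
    then show "measure (?U l) (bad_offsets x l) \<le> 42 * real M ^ 3 * \<delta>"
      using sub by (subst measure_uniform_count_measure) auto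
  qed
  also have "\<dots> = (42 * real M ^ 3 * \<delta>) ^ n" by simp
  finally show "measure (dyadic_prob \<delta>) ?E \<le> (42 * real M ^ 3 * \<delta>) ^ n" .
qed

lemma prob_eps_boundary:
  assumes "doubling_constant TYPE('a) M" "\<delta> \<le> 1 / 4" "\<epsilon> > 0" "\<epsilon> \<le> \<delta> powi (k + int n)"
  shows "measure (dyadic_prob \<delta>) {\<omega> \<in> space (dyadic_prob \<delta>).
      x \<in> (\<Union>\<alpha>\<in>N k. eps_boundary \<epsilon> (random_closed_cube \<delta> N z k \<alpha> \<omega>))}
    \<le> (42 * real M ^ 3 * \<delta>) ^ n"
proof -
  interpret prob_space "dyadic_prob \<delta>" by (rule prob_space_dyadic_prob)
  \<comment> \<open>The finest generation used is \<open>l = k + int n - 1\<close>, where this is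
    the hypothesis itself; at coarser ones the right-hand side is larger.\<close>
  have eps: "\<epsilon> \<le> \<delta> powi (l + 1)" if "l < k + int n" for l
    using power_int_decreasing[of "l + 1" "k + int n" \<delta>] delta_pos delta_small that assms(4)
    by simp
  have "\<omega> l \<in> bad_offsets x l"
    if "\<omega> \<in> space (dyadic_prob \<delta>)" "l \<in> {k..<k + int n}"
      "x \<in> eps_boundary \<epsilon> (random_closed_cube \<delta> N z k \<alpha> \<omega>)" for \<omega> l \<alpha>
    using that assms(3) eps space_dyadic_prob by (intro bad_offsets_eps_boundary) auto
  then have "{\<omega> \<in> space (dyadic_prob \<delta>).
      x \<in> (\<Union>\<alpha>\<in>N k. eps_boundary \<epsilon> (random_closed_cube \<delta> N z k \<alpha> \<omega>))}
    \<subseteq> {\<omega> \<in> space (dyadic_prob \<delta>). \<forall>l\<in>{k..<k + int n}. \<omega> l \<in> bad_offsets x l}"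
    by blast
  then show ?thesis
    using finite_measure_mono[OF _ prob_bad_offsets(1)[OF assms(1,2)]]
      prob_bad_offsets(2)[OF assms(1,2), of k n x] by (meson order_trans)
qed

end

section \<open>The exponent and the final estimate\<close>

lemma power_sandwich:
  fixes t d :: real
  assumes "0 < t" "t \<le> 1" "d < 1"
  shows "\<exists>n. d ^ Suc n < t \<and> t \<le> d ^ n"
proof -
  obtain n where "d ^ n < t" using real_arch_pow_inv[OF assms(1,3)] by blast
  moreover from this have "n \<noteq> 0" using assms(2) by (intro notI) simp
  ultimately have ex: "\<exists>n. d ^ Suc n < t" by (metis not0_implies_Suc)
  define n where "n = (LEAST n. d ^ Suc n < t)"
  have "d ^ Suc n < t" unfolding n_def using ex by (rule LeastI_ex)
  moreover have "t \<le> d ^ n"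
  proof (cases n)
    case (Suc m)
    then have "\<not> d ^ Suc m < t" using not_less_Least[of m "\<lambda>n. d ^ Suc n < t"] n_def by simp
    then show ?thesis using Suc by simp
  qed (use assms(2) in simp)
  ultimately show ?thesis by blast
qed

text \<open>The correction term in the exponent contributes the factor
  \<open>\<delta> powr (- ln (C_const M) / ln (1 / \<delta>))\<close>, which is
  \<open>C_const M\<close> because \<open>ln (1 / \<delta>) = - ln \<delta>\<close>.\<close>

lemma powr_eta:
  assumes "0 < \<delta>" "\<delta> < 1" "M > 0"
  shows "\<delta> powr eta M \<delta> = C_const M * \<delta>"
proof -
  have "ln \<delta> < 0" using assms by simp
  then have "eta M \<delta> * ln \<delta> = ln \<delta> + ln (C_const M)"
    using assms by (simp add: eta_def ln_div field_simps)
  moreover have "C_const M > 0" using assms by (simp add: C_const_def)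
  ultimately show ?thesis using assms by (simp add: powr_def exp_add)
qed

lemma tendsto_eta: "(eta M \<longlongrightarrow> 1) (at_right 0)"
proof -
  have "filterlim (\<lambda>d::real. ln (inverse d)) at_top (at_right 0)"
    by (rule filterlim_compose[OF ln_at_top filterlim_inverse_at_top_right])
  then have "filterlim (\<lambda>d::real. ln (1 / d)) at_infinity (at_right 0)"
    by (simp add: inverse_eq_divide filterlim_at_top_imp_at_infinity)
  then have "((\<lambda>d. 1 - ln (C_const M) / ln (1 / d)) \<longlongrightarrow> 1 - 0) (at_right 0)"
    by (intro tendsto_diff tendsto_const tendsto_divide_0[OF tendsto_const])
  then show ?thesis by (simp add: eta_def[abs_def])
qed

theorem theorem5p2:
  fixes M :: nat and \<delta> :: real
    and N :: "int \<Rightarrow> nat set" and z :: "int \<Rightarrow> nat \<Rightarrow> 'a::metric_space"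
  assumes "doubling_constant TYPE('a) M"
    and "0 < \<delta>" and "\<delta> < 1 / (84 * real M ^ 8)"
    and "dyadic_points \<delta> N z"
  shows "(\<forall>\<epsilon>>0. \<forall>(k::int) (x::'a).
            {\<omega> \<in> space (dyadic_prob \<delta>).
               x \<in> (\<Union>\<alpha>\<in>N k. eps_boundary \<epsilon> (random_closed_cube \<delta> N z k \<alpha> \<omega>))}
              \<in> sets (dyadic_prob \<delta>) \<and>
            measure (dyadic_prob \<delta>)
              {\<omega> \<in> space (dyadic_prob \<delta>).
                 x \<in> (\<Union>\<alpha>\<in>N k. eps_boundary \<epsilon> (random_closed_cube \<delta> N z k \<alpha> \<omega>))}
              \<le> 1 / \<delta> * (\<epsilon> / \<delta> powi k) powr eta M \<delta>) \<and>
         (eta M \<longlongrightarrow> 1) (at_right 0)"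
proof (intro conjI allI impI)
  \<comment> \<open>For \<open>M = 0\<close> the upper bound on \<open>\<delta>\<close> is a
    division by zero, hence 0, which contradicts \<open>0 < \<delta>\<close>.\<close>
  have M: "M > 0" using assms(2,3) by (cases "M = 0") auto
  then have M8: "real M ^ 8 \<ge> 1" by simp
  then have C: "C_const M \<ge> 84" and Cpos: "C_const M > 0" using M by (simp_all add: C_const_def)
  have Cd: "C_const M * \<delta> < 1"
    using assms(3) M by (simp add: C_const_def field_simps)
  have d84: "\<delta> * 84 < 1"
    using mult_left_mono[OF C, of \<delta>] Cd assms(2) by (simp only: mult.commute) linarith
  have "real M ^ 3 \<le> real M ^ 8" using M by (intro power_increasing) auto
  then have "42 * real M ^ 3 \<le> C_const M" using M8 by (simp add: C_const_def)
  then have CM: "42 * real M ^ 3 * \<delta> \<le> C_const M * \<delta>"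
    using assms(2) by (intro mult_right_mono) auto
  \<comment> \<open>This gives a nonnegative exponent, so that \<open>powr\<close> is monotone in
    its base.\<close>
  have "ln (C_const M) \<le> ln (1 / \<delta>)"
    using Cd Cpos assms(2) by (subst ln_le_cancel_iff) (auto simp: field_simps)
  moreover have "ln (1 / \<delta>) > 0" using d84 assms(2) by (intro ln_gt_zero) (auto simp: field_simps)
  ultimately have eta: "eta M \<delta> \<ge> 0" by (simp add: eta_def)
  interpret dyadic_grid \<delta> N z using assms(2,4) d84 by unfold_locales auto
  interpret prob_space "dyadic_prob \<delta>" by (rule prob_space_dyadic_prob)
  fix \<epsilon> :: real and k x assume e: "\<epsilon> > 0"
  let ?E = "{\<omega> \<in> space (dyadic_prob \<delta>).
      x \<in> (\<Union>\<alpha>\<in>N k. eps_boundary \<epsilon> (random_closed_cube \<delta> N z k \<alpha> \<omega>))}"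
  show "?E \<in> sets (dyadic_prob \<delta>)"
    using pred_eps_boundary[OF e] by (simp only: pred_def)
  define t where "t = \<epsilon> / \<delta> powi k"
  have t: "t > 0" "\<epsilon> = t * \<delta> powi k" using e assms(2) by (simp_all add: t_def)
  have "measure (dyadic_prob \<delta>) ?E \<le> 1 / \<delta> * t powr eta M \<delta>"
  proof (cases "t \<le> 1")
    \<comment> \<open>For \<open>t > 1\<close> the claimed bound is at least 1.\<close>
    case False
    then have "1 \<le> t powr eta M \<delta>" using eta by (intro ge_one_powr_ge_zero) auto
    moreover have "1 \<le> 1 / \<delta>" using assms(2) d84 by (simp add: field_simps)
    ultimately have "1 * 1 \<le> 1 / \<delta> * t powr eta M \<delta>"
      using assms(2) by (intro mult_mono) auto
    then show ?thesis using prob_le_1[of ?E] by linarith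
  next
    case True
    \<comment> \<open>The upper bound on \<open>t\<close> constrains \<open>n\<close> generations;
      the lower bound turns the resulting power of \<open>\<delta>\<close> back into a power of
      \<open>t\<close>.\<close>
    then obtain n where n: "\<delta> ^ Suc n < t" "t \<le> \<delta> ^ n"
      using power_sandwich[OF t(1) True, of \<delta>] delta_small by auto
    have "\<epsilon> \<le> \<delta> powi (k + int n)"
      using mult_right_mono[OF n(2), of "\<delta> powi k"] t(2) assms(2)
      by (simp add: power_int_add mult.commute)
    then have "measure (dyadic_prob \<delta>) ?E \<le> (42 * real M ^ 3 * \<delta>) ^ n"
      using d84 by (intro prob_eps_boundary assms(1) e) auto
    also have "\<dots> \<le> (C_const M * \<delta>) ^ n"
      using CM assms(2) by (intro power_mono) auto
    \<comment> \<open>An extra factor \<open>C_const M \<ge> 1\<close> raises the exponent from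
      \<open>n\<close> to \<open>Suc n\<close>; the factor \<open>\<delta>\<close> missing for this
      is the origin of the constant \<open>1 / \<delta>\<close>.\<close>
    also have "\<dots> \<le> C_const M * (C_const M * \<delta>) ^ n"
      using C assms(2) by simp
    also have "\<dots> = 1 / \<delta> * (\<delta> powr eta M \<delta>) ^ Suc n"
      using powr_eta[of \<delta> M] assms(2) d84 M by simp
    also have "(\<delta> powr eta M \<delta>) ^ Suc n = (\<delta> ^ Suc n) powr eta M \<delta>"
      using assms(2) by (simp add: powr_power powr_powr mult.commute flip: powr_realpow del: power_Suc)
    also have "1 / \<delta> * \<dots> \<le> 1 / \<delta> * t powr eta M \<delta>"
      using n(1) eta assms(2) by (intro mult_left_mono powr_mono2) auto
    finally show ?thesis .
  qed
  then show "measure (dyadic_prob \<delta>) ?E \<le> 1 / \<delta> * (\<epsilon> / \<delta> powi k) powr eta M \<delta>"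
    by (simp only: t_def)
qed (rule tendsto_eta)

end
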